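(* Let $X$ be a compact metrizable space and $T:X\to X$ a homeomorphism. Then $$\sharp\mathcal M_e(X,T)\leq\mathrm{Mult}(T)$$ in $\mathbb N\cup\{\infty\}$.
   Context: $\mathcal M_e(X,T)$ is the set of ergodic $T$-invariant Borel probability measures on $X$, and $\sharp$ denotes cardinality (with value $\infty$ for any infinite set). The topological multiplicity $\mathrm{Mult}(T)\in\mathbb N\cup\{\infty\}$ is the smallest cardinality of a set $F\subset C(X)$ such that the linear span of $\{f\circ T^n: f\in F,\ n\in\mathbb Z\}$ is dense in the Banach space $C(X)$ of real continuous functions with the supremum norm ($\infty$ if no finite such set exists). *)

theory Defs
  imports "HOL-Probability.Probability"
begin

definition ecard :: "'a set \<Rightarrow> enat" where
  "ecard A = (if finite A then enat (card A) else \<infinity>)"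

definition borel_measure_on :: "'a topology \<Rightarrow> 'a measure \<Rightarrow> bool" where
  "borel_measure_on X M \<longleftrightarrow>
     space M = topspace X \<and> sets M = sigma_sets (topspace X) {U. openin X U}"

definition invariant_measure :: "('a \<Rightarrow> 'a) \<Rightarrow> 'a measure \<Rightarrow> bool" where
  "invariant_measure T M \<longleftrightarrow> T \<in> M \<rightarrow>\<^sub>M M \<and> distr M M T = M"

definition ergodic_measure :: "('a \<Rightarrow> 'a) \<Rightarrow> 'a measure \<Rightarrow> bool" where
  "ergodic_measure T M \<longleftrightarrow> invariant_measure T M \<and>
     (\<forall>A \<in> sets M. T -` A \<inter> space M = A \<longrightarrow> measure M A = 0 \<or> measure M A = 1)"

definition ergodic_measures :: "'a topology \<Rightarrow> ('a \<Rightarrow> 'a) \<Rightarrow> 'a measure set" where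
  "ergodic_measures X T = {M. borel_measure_on X M \<and> prob_space M \<and> ergodic_measure T M}"

(* T only matters on the carrier of X, so negative iterates use the inverse relative to it. *)
definition int_iterate :: "'a topology \<Rightarrow> ('a \<Rightarrow> 'a) \<Rightarrow> int \<Rightarrow> 'a \<Rightarrow> 'a" where
  "int_iterate X T n =
     (if n \<ge> 0 then T ^^ nat n else inv_into (topspace X) T ^^ nat (- n))"

(* C(X) with its sup metric. For compact X the boundedness built into cfunspace is automatic.
   Its elements are extensional (undefined off the carrier of X), which is why the functions
   formed below are restricted to the carrier. *)
abbreviation C_metric :: "'a topology \<Rightarrow> ('a \<Rightarrow> real) metric" where
  "C_metric X \<equiv> cfunspace X euclidean_metric"

definition translates :: "'a topology \<Rightarrow> ('a \<Rightarrow> 'a) \<Rightarrow> ('a \<Rightarrow> real) set \<Rightarrow> ('a \<Rightarrow> real) set" where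
  "translates X T F = {restrict (f \<circ> int_iterate X T n) (topspace X) | f n. f \<in> F}"

definition linear_span_on :: "'a topology \<Rightarrow> ('a \<Rightarrow> real) set \<Rightarrow> ('a \<Rightarrow> real) set" where
  "linear_span_on X G =
     {restrict (\<lambda>x. \<Sum>g\<in>S. c g * g x) (topspace X) | S c. finite S \<and> S \<subseteq> G}"

definition cyclic_family :: "'a topology \<Rightarrow> ('a \<Rightarrow> 'a) \<Rightarrow> ('a \<Rightarrow> real) set \<Rightarrow> bool" where
  "cyclic_family X T F \<longleftrightarrow> F \<subseteq> mspace (C_metric X) \<and>
     mtopology_of (C_metric X) closure_of (linear_span_on X (translates X T F))
       = mspace (C_metric X)"

definition Mult :: "'a topology \<Rightarrow> ('a \<Rightarrow> 'a) \<Rightarrow> enat" where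
  "Mult X T = (INF F \<in> {F. cyclic_family X T F}. ecard F)"

end

theory Submission
  imports Defs
begin

text \<open>If there were more ergodic measures than functions in a finite cyclic family, some nontrivial
  combination of these measures would integrate every function of the family to zero. By
  invariance and density it integrates every continuous function to zero, so it is the zero
  signed measure. But distinct ergodic measures are mutually singular, hence linearly independent.\<close>

section \<open>Linear algebra: more unknowns than homogeneous equations\<close>

text \<open>Gaussian elimination, by induction on the set of equations: each new equation either is
  vacuous or eliminates one unknown, so at least one unknown remains free.\<close>

lemma exists_nontrivial_relation:
  fixes a :: "'i \<Rightarrow> 'j \<Rightarrow> 'k::field"
  assumes "finite J" "finite I" "card J < card I"
  obtains c where "\<exists>i\<in>I. c i \<noteq> 0" "\<And>j. j \<in> J \<Longrightarrow> (\<Sum>i\<in>I. c i * a i j) = 0"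
proof -
  from assms have "\<exists>c. (\<exists>i\<in>I. c i \<noteq> 0) \<and> (\<forall>j\<in>J. (\<Sum>i\<in>I. c i * a i j) = 0)"
  proof (induction J arbitrary: I a rule: finite_induct)
    case empty
    then have "I \<noteq> {}" by auto
    then show ?case by (intro exI[of _ "\<lambda>_. 1"]) auto
  next
    case (insert k J)
    show ?case
    proof (cases "\<forall>i\<in>I. a i k = 0")
      case True
      have "card J < card I" using insert by simp
      from insert.IH[OF insert.prems(1) this, of a]
      obtain c where "\<exists>i\<in>I. c i \<noteq> 0" "\<forall>j\<in>J. (\<Sum>i\<in>I. c i * a i j) = 0" by blast
      with True show ?thesis by (intro exI[of _ c]) auto
    next
      case False
      then obtain p where p: "p \<in> I" "a p k \<noteq> 0" by blast
      define I' where "I' = I - {p}"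
      have I': "finite I'" "card J < card I'" "p \<notin> I'" "I = insert p I'"
        using insert p by (auto simp: I'_def)
      \<comment> \<open>Row \<open>p\<close> is the pivot. Subtracting its multiple
        \<open>a i k / a p k\<close> from row \<open>i\<close> clears column \<open>k\<close>, so
        the reduced system involves only \<open>J\<close> and \<open>I'\<close>.\<close>
      from insert.IH[OF I'(1,2), of "\<lambda>i j. a i j - a i k / a p k * a p j"]
      obtain c where c: "\<exists>i\<in>I'. c i \<noteq> 0"
        "\<And>j. j \<in> J \<Longrightarrow> (\<Sum>i\<in>I'. c i * (a i j - a i k / a p k * a p j)) = 0" by blast
      \<comment> \<open>\<open>q\<close> is the coefficient of \<open>p\<close> that solves equation
        \<open>k\<close>. With this value, the reduced equations for \<open>j\<close> in
        \<open>J\<close> turn back into the original ones.\<close>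
      define q where "q = - (\<Sum>i\<in>I'. c i * a i k) / a p k"
      define c' where "c' = c(p := q)"
      have sum_c': "(\<Sum>i\<in>I. c' i * a i j) = q * a p j + (\<Sum>i\<in>I'. c i * a i j)" for j
      proof -
        have "(\<Sum>i\<in>I'. c' i * a i j) = (\<Sum>i\<in>I'. c i * a i j)"
          using I'(3) by (intro sum.cong) (auto simp: c'_def)
        then show ?thesis using I' by (simp add: c'_def)
      qed
      have "(\<Sum>i\<in>I. c' i * a i j) = 0" if "j \<in> J" for j
      proof -
        have "0 = (\<Sum>i\<in>I'. c i * a i j) - (\<Sum>i\<in>I'. c i * a i k) / a p k * a p j"
          using c(2)[OF that]
          by (simp add: right_diff_distrib sum_subtractf sum_distrib_right sum_divide_distrib mult.assoc)
        then show ?thesis by (simp add: sum_c' q_def)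
      qed
      moreover have "(\<Sum>i\<in>I. c' i * a i k) = 0"
        using p by (simp add: sum_c' q_def)
      moreover have "\<exists>i\<in>I. c' i \<noteq> 0"
        using c(1) I'(3,4) by (auto simp: c'_def)
      ultimately show ?thesis by (intro exI[of _ c']) auto
    qed
  qed
  with that show ?thesis by blast
qed

section \<open>Mutual singularity and linear independence of ergodic measures\<close>

lemma invariant_measure_vimage:
  assumes "invariant_measure T M" "A \<in> sets M"
  shows "measure M (T -` A \<inter> space M) = measure M A"
  using assms measure_distr[of T M M A] by (simp add: invariant_measure_def)

text \<open>The Hahn sets are the maximisers of \<open>\<mu> - \<nu>\<close>, and they are closed under preimages, unions
  and monotone limits. So the limit superior of the iterated preimages of one Hahn set is again
  a Hahn set, and it is strictly invariant.\<close>

lemma invariant_Hahn_set: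
  assumes M: "finite_measure M" "invariant_measure T M"
    and N: "finite_measure N" "invariant_measure T N"
    and sets_eq: "sets N = sets M"
  obtains B where "B \<in> sets M" "T -` B \<inter> space M = B"
    "\<And>A. A \<in> sets M \<Longrightarrow> measure M A - measure N A \<le> measure M B - measure N B"
proof -
  interpret M: finite_measure M by fact
  interpret N: finite_measure N by fact
  have sp: "space N = space M" using sets_eq by (rule sets_eq_imp_space_eq)
  define e where "e A = measure M A - measure N A" for A
  have T: "T \<in> M \<rightarrow>\<^sub>M M" using M(2) by (simp add: invariant_measure_def)
  obtain Y where Y: "Y \<in> sets M" and Y1: "\<forall>Z\<in>sets M. Z \<subseteq> Y \<longrightarrow> N Z \<le> M Z"
    and Y2: "\<forall>Z\<in>sets M. Z \<inter> Y = {} \<longrightarrow> M Z \<le> N Z"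
    using finite_unsigned_Hahn_decomposition[OF M(1) N(1) sets_eq] by blast
  \<comment> \<open>Passing from \<open>Y\<close> to \<open>A\<close> removes \<open>Y - A\<close>,
    where \<open>M\<close> dominates \<open>N\<close>, and adds \<open>A - Y\<close>, where
    \<open>N\<close> dominates \<open>M\<close>. Neither change can increase
    \<open>e\<close>.\<close>
  have max: "e A \<le> e Y" if A: "A \<in> sets M" for A
  proof -
    have "N (Y - A) \<le> M (Y - A)" "M (A - Y) \<le> N (A - Y)" using A Y Y1 Y2 by auto
    then have "measure N (Y - A) \<le> measure M (Y - A)" "measure M (A - Y) \<le> measure N (A - Y)"
      by (simp_all add: M.emeasure_eq_measure N.emeasure_eq_measure)
    moreover have "measure M A = measure M (A \<inter> Y) + measure M (A - Y)"
      "measure N A = measure N (A \<inter> Y) + measure N (A - Y)"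
      "measure M Y = measure M (A \<inter> Y) + measure M (Y - A)"
      "measure N Y = measure N (A \<inter> Y) + measure N (Y - A)"
      using A Y M.finite_measure_Diff'[of A Y] N.finite_measure_Diff'[of A Y]
        M.finite_measure_Diff'[of Y A] N.finite_measure_Diff'[of Y A] sets_eq
      by (auto simp: Int_commute)
    ultimately show ?thesis by (simp add: e_def)
  qed
  define P where "P A \<longleftrightarrow> A \<in> sets M \<and> e A = e Y" for A
  \<comment> \<open>By inclusion-exclusion, the values of \<open>e\<close> at the union and at the
    intersection add up to \<open>2 * e Y\<close>. Neither exceeds \<open>e Y\<close>, so both equal
    it.\<close>
  have P_Un: "P (A \<union> C)" if "P A" "P C" for A C
  proof -
    have AC: "A \<in> sets M" "C \<in> sets M" using that by (auto simp: P_def)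
    have "measure M (A \<union> C) = measure M A + measure M C - measure M (A \<inter> C)"
      "measure N (A \<union> C) = measure N A + measure N C - measure N (A \<inter> C)"
      using AC sets_eq by (auto intro!: measure_Un3 simp: M.fmeasurable_eq_sets N.fmeasurable_eq_sets)
    then have "e (A \<union> C) = e A + e C - e (A \<inter> C)" by (simp add: e_def)
    with max[of "A \<union> C"] max[of "A \<inter> C"] that AC show ?thesis by (auto simp: P_def)
  qed
  have P_incseq: "P (\<Union>n. A n)" if "incseq A" "\<And>n. P (A n)" for A :: "nat \<Rightarrow> _"
  proof -
    have A: "range A \<subseteq> sets M" using that(2) by (auto simp: P_def)
    have "(\<lambda>n. e (A n)) \<longlonglongrightarrow> e (\<Union>n. A n)"
      unfolding e_def using A sets_eq that(1)
      by (intro tendsto_diff M.finite_Lim_measure_incseq N.finite_Lim_measure_incseq) auto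
    moreover have "(\<lambda>n. e (A n)) \<longlonglongrightarrow> e Y" using that(2) by (simp add: P_def)
    ultimately have "e (\<Union>n. A n) = e Y" by (rule LIMSEQ_unique)
    with A show ?thesis by (auto simp: P_def)
  qed
  have P_decseq: "P (\<Inter>n. A n)" if "decseq A" "\<And>n. P (A n)" for A :: "nat \<Rightarrow> _"
  proof -
    have A: "range A \<subseteq> sets M" using that(2) by (auto simp: P_def)
    have "(\<lambda>n. e (A n)) \<longlonglongrightarrow> e (\<Inter>n. A n)"
      unfolding e_def using A sets_eq that(1)
      by (intro tendsto_diff M.finite_Lim_measure_decseq N.finite_Lim_measure_decseq) auto
    moreover have "(\<lambda>n. e (A n)) \<longlonglongrightarrow> e Y" using that(2) by (simp add: P_def)
    ultimately have "e (\<Inter>n. A n) = e Y" by (rule LIMSEQ_unique)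
    with A show ?thesis by (auto simp: P_def)
  qed
  \<comment> \<open>The iterated preimages of \<open>Y\<close>. Both measures are invariant, so each
    preimage has the same value of \<open>e\<close> and is again a maximiser.\<close>
  define D where "D j = ((\<lambda>A. T -` A \<inter> space M) ^^ j) Y" for j
  have D_Suc: "D (Suc j) = T -` D j \<inter> space M" for j by (simp add: D_def)
  have P_D: "P (D j)" for j
  proof (induction j)
    case 0
    show ?case using Y by (simp add: P_def D_def)
  next
    case (Suc j)
    then have "D j \<in> sets M" by (simp add: P_def)
    with Suc T invariant_measure_vimage[OF M(2), of "D j"] invariant_measure_vimage[OF N(2), of "D j"]
    show ?case by (simp add: P_def D_Suc e_def sets_eq sp measurable_sets)
  qed
  define V where "V k = (\<Union>j\<in>{k..}. D j)" for k
  have P_V: "P (V k)" for k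
  proof -
    \<comment> \<open>The tail union is reached through an increasing sequence of finite unions,
      starting from the single set \<open>D k\<close>.\<close>
    define U where "U n = (\<Union>j\<in>{k..k+n}. D j)" for n
    have "P (U n)" for n
    proof (induction n)
      case 0
      show ?case using P_D by (simp add: U_def)
    next
      case (Suc n)
      have "U (Suc n) = U n \<union> D (k + Suc n)" by (auto simp: U_def atLeastAtMostSuc_conv)
      with Suc P_D P_Un show ?case by simp
    qed
    moreover have "incseq U" unfolding U_def by (intro monoI UN_mono) auto
    ultimately have "P (\<Union>n. U n)" by (intro P_incseq)
    also have "(\<Union>n. U n) = V k"
    proof
      show "V k \<subseteq> (\<Union>n. U n)"
      proof
        fix x assume "x \<in> V k"
        then obtain j where "k \<le> j" "x \<in> D j" by (auto simp: V_def)
        then have "x \<in> U (j - k)" by (auto simp: U_def)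
        then show "x \<in> (\<Union>n. U n)" by blast
      qed
    qed (auto simp: U_def V_def)
    finally show ?thesis .
  qed
  have dec: "decseq V" unfolding V_def by (intro antimonoI UN_mono) auto
  define B where "B = (\<Inter>k. V k)"
  have "P B" unfolding B_def by (intro P_decseq dec P_V)
  \<comment> \<open>Taking preimages shifts the sequence \<open>D\<close>, hence its tails, by one
    index.\<close>
  have V_Suc: "T -` V k \<inter> space M = V (Suc k)" for k
  proof -
    have "{Suc k..} = Suc ` {k..}" by (auto simp: image_iff Bex_def dest: Suc_le_D)
    then have "V (Suc k) = (\<Union>j\<in>{k..}. D (Suc j))" by (simp add: V_def)
    then show ?thesis by (auto simp: V_def D_Suc)
  qed
  \<comment> \<open>The preimage of \<open>B\<close> is the intersection of all tails but
    \<open>V 0\<close>. As the tails decrease, omitting \<open>V 0\<close> changes nothing.\<close>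
  have "T -` B \<inter> space M = (\<Inter>k. V (Suc k))"
    unfolding B_def V_Suc[symmetric] by auto
  also have "\<dots> = B"
  proof
    show "(\<Inter>k. V (Suc k)) \<subseteq> B"
      using decseq_SucD[OF dec] by (auto simp: B_def)
  qed (auto simp: B_def)
  finally have inv: "T -` B \<inter> space M = B" .
  show thesis
  proof (rule that[of B])
    show "B \<in> sets M" using \<open>P B\<close> by (simp add: P_def)
    show "T -` B \<inter> space M = B" by (rule inv)
    show "measure M A - measure N A \<le> measure M B - measure N B" if "A \<in> sets M" for A
      using max[OF that] \<open>P B\<close> by (simp add: P_def e_def)
  qed
qed

text \<open>By ergodicity an invariant Hahn set has measure 0 or 1 under each of the two measures.
  The difference of these values is positive because the measures differ, which leaves only 1 and
  0.\<close>

lemma ergodic_measures_mutually_singular: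
  assumes M: "prob_space M" "ergodic_measure T M"
    and N: "prob_space N" "ergodic_measure T N"
    and sets_eq: "sets N = sets M" and neq: "M \<noteq> N"
  obtains B where "B \<in> sets M" "measure M B = 1" "measure N B = 0"
proof -
  interpret M: prob_space M by fact
  interpret N: prob_space N by fact
  have sp: "space N = space M" using sets_eq by (rule sets_eq_imp_space_eq)
  obtain B where B: "B \<in> sets M" "T -` B \<inter> space M = B"
    and max: "\<And>A. A \<in> sets M \<Longrightarrow> measure M A - measure N A \<le> measure M B - measure N B"
    using invariant_Hahn_set[of M T N] M N sets_eq M.finite_measure_axioms N.finite_measure_axioms
    unfolding ergodic_measure_def by blast
  have "measure M B - measure N B > 0"
  proof (rule ccontr)
    assume "\<not> ?thesis"
    \<comment> \<open>A nonpositive maximum means that \<open>M\<close> lies below \<open>N\<close>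
      on every set. Complements reverse the inequality because both total masses are 1.\<close>
    then have le: "measure M A \<le> measure N A" if "A \<in> sets M" for A
      using max[OF that] by simp
    have "measure M A = measure N A" if A: "A \<in> sets M" for A
    proof (rule antisym)
      have "1 - measure M A \<le> 1 - measure N A"
        using le[of "space M - A"] A M.prob_compl[of A] N.prob_compl[of A] sets_eq sp by simp
      then show "measure N A \<le> measure M A" by simp
    qed (rule le[OF A])
    then have "M = N"
      using sets_eq by (intro measure_eqI) (auto simp: M.emeasure_eq_measure N.emeasure_eq_measure)
    with neq show False by contradiction
  qed
  moreover have "measure M B = 0 \<or> measure M B = 1" "measure N B = 0 \<or> measure N B = 1"
    using M(2) N(2) B sets_eq sp by (auto simp: ergodic_measure_def)
  ultimately have "measure M B = 1" "measure N B = 0" by auto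
  with B that show thesis by blast
qed

text \<open>For each \<open>M\<close> there is a set of full \<open>M\<close>-measure that is null
  for all other members of \<open>I\<close>. Evaluating the relation there isolates
  \<open>c M\<close>.\<close>

lemma ergodic_measures_linearly_independent:
  assumes "finite I"
    and I: "\<And>M. M \<in> I \<Longrightarrow> prob_space M \<and> ergodic_measure T M \<and> sets M = \<Sigma>"
    and zero: "\<And>A. A \<in> \<Sigma> \<Longrightarrow> (\<Sum>M\<in>I. c M * measure M A) = 0"
    and "M \<in> I"
  shows "c M = 0"
proof -
  interpret M: prob_space M using I \<open>M \<in> I\<close> by blast
  have "\<exists>B. B \<in> sets M \<and> measure M B = 1 \<and> measure N B = 0" if "N \<in> I - {M}" for N
    using ergodic_measures_mutually_singular[of M T N] I \<open>M \<in> I\<close> that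
    by (metis DiffE singletonI)
  then obtain B where B: "\<And>N. N \<in> I - {M} \<Longrightarrow> B N \<in> sets M \<and> measure M (B N) = 1 \<and> measure N (B N) = 0"
    by metis
  \<comment> \<open>The intersection of the separating sets is taken inside \<open>space M\<close>,
    so that it is all of \<open>space M\<close> when \<open>M\<close> is the only member of
    \<open>I\<close>.\<close>
  define C where "C = {x \<in> space M. \<forall>N\<in>I - {M}. x \<in> B N}"
  have C: "C \<in> sets M"
    unfolding C_def
  proof (intro sets.sets_Collect_finite_All)
    show "{x \<in> space M. x \<in> B N} \<in> sets M" if "N \<in> I - {M}" for N
      using B[OF that] by (simp add: Collect_conj_eq Int_def[symmetric])
  qed (use \<open>finite I\<close> in simp)
  have "AE x in M. x \<in> C"
  proof -
    have "AE x in M. \<forall>N\<in>I - {M}. x \<in> B N"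
      using B \<open>finite I\<close> by (intro AE_finite_allI) (auto simp: M.prob_eq_1[symmetric])
    then show ?thesis using AE_space by eventually_elim (auto simp: C_def)
  qed
  then have MC: "measure M C = 1" using C by (simp add: M.prob_eq_1)
  have NC: "measure N C = 0" if N: "N \<in> I - {M}" for N
  proof -
    interpret N: prob_space N using I N by blast
    have "measure N C \<le> measure N (B N)"
      using N B[OF N] I \<open>M \<in> I\<close> C by (intro N.finite_measure_mono) (auto simp: C_def)
    then show ?thesis using B[OF N] measure_nonneg[of N C] by linarith
  qed
  have "0 = (\<Sum>N\<in>I. c N * measure N C)" using zero C I \<open>M \<in> I\<close> by auto
  also have "\<dots> = c M * measure M C + (\<Sum>N\<in>I - {M}. c N * measure N C)"
    using \<open>finite I\<close> \<open>M \<in> I\<close> by (rule sum.remove)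
  also have "\<dots> = c M" using MC NC by simp
  finally show ?thesis by simp
qed

section \<open>Integrals of continuous functions determine Borel measures\<close>

lemma continuous_map_borel_measure_on:
  assumes "borel_measure_on X M" "continuous_map X euclidean f"
  shows "f \<in> borel_measurable M"
proof (rule borel_measurableI)
  fix S :: "'b set" assume "open S"
  then have "openin X {x \<in> topspace X. f x \<in> S}"
    using assms(2) by (auto simp: continuous_map_def)
  moreover have "f -` S \<inter> space M = {x \<in> topspace X. f x \<in> S}"
    using assms(1) by (auto simp: borel_measure_on_def)
  ultimately show "f -` S \<inter> space M \<in> sets M"
    using assms(1) by (auto simp: borel_measure_on_def)
qed

lemma mspace_C_metric:
  assumes "compact_space X"
  shows "mspace (C_metric X) = {f \<in> extensional (topspace X). continuous_map X euclideanreal f}"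
  using assms compactin_mspace_cfunspace[of X euclidean_metric]
  by (auto simp: compact_space_def)

lemma integrable_C_metric:
  assumes "borel_measure_on X M" "finite_measure M" "f \<in> mspace (C_metric X)"
  shows "integrable M f"
proof -
  interpret finite_measure M by fact
  have "bounded (f ` topspace X)" using assms(3) by simp
  then obtain b where "\<forall>x\<in>topspace X. \<bar>f x\<bar> \<le> b" by (auto simp: bounded_iff)
  with assms show ?thesis
    by (intro integrable_const_bound[of _ b] continuous_map_borel_measure_on)
      (auto simp: borel_measure_on_def)
qed

text \<open>An open set in a metrizable space is an increasing union of closed sets. Urysohn
  functions that are 1 on these and 0 off the open set converge pointwise to its indicator, and
  dominated convergence applies. One sequence \<open>g\<close> serves all measures at once, so a
  linear relation between integrals survives the limit.\<close>

lemma integral_open_set_tendsto: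
  assumes "metrizable_space X" "openin X U"
  obtains g where "\<And>n::nat. g n \<in> mspace (C_metric X)"
    "\<And>M. borel_measure_on X M \<Longrightarrow> finite_measure M \<Longrightarrow>
      (\<lambda>n. integral\<^sup>L M (g n)) \<longlonglongrightarrow> measure M U"
proof -
  obtain C where C: "\<And>n. closedin X (C n)" "\<And>n. C n \<subseteq> C (Suc n)" "\<Union> (range C) = U"
    using open_imp_fsigma_in[OF assms] unfolding fsigma_in_ascending by blast
  have "\<exists>f. continuous_map X (top_of_set {0..1::real}) f \<and> f ` (topspace X - U) \<subseteq> {0} \<and> f ` C n \<subseteq> {1}" for n
  proof -
    have "disjnt (topspace X - U) (C n)" using C(3) by (auto simp: disjnt_def)
    with Urysohn_lemma[OF metrizable_imp_normal_space[OF assms(1)], of "topspace X - U" "C n" 0 1] C assms(2)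
    show ?thesis by (metis closedin_diff closedin_topspace zero_le_one)
  qed
  then obtain f where f: "\<And>n. continuous_map X (top_of_set {0..1::real}) (f n)"
    "\<And>n. f n ` (topspace X - U) \<subseteq> {0}" "\<And>n. f n ` C n \<subseteq> {1}" by metis
  define g where "g n = restrict (f n) (topspace X)" for n
  have cont: "continuous_map X euclideanreal (g n)" for n
    using f(1)[of n] unfolding continuous_map_in_subtopology g_def
    by (auto intro: continuous_map_eq)
  have g01: "g n x \<in> {0..1}" if "x \<in> topspace X" for n x
    using f(1)[of n] that by (auto simp: continuous_map_in_subtopology g_def)
  have g_lim: "(\<lambda>n. g n x) \<longlonglongrightarrow> indicat_real U x" if x: "x \<in> topspace X" for x
  proof (cases "x \<in> U")
    case True
    then obtain n0 where "x \<in> C n0" using C(3) by auto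
    \<comment> \<open>The sets \<open>C n\<close> increase, so from \<open>n0\<close> on every
      \<open>g n\<close> takes the value 1 at \<open>x\<close>.\<close>
    then have "x \<in> C n" if "n \<ge> n0" for n
      using lift_Suc_mono_le[of C, OF C(2) that] by blast
    then have "\<forall>\<^sub>F n in sequentially. g n x = 1"
      using f(3) x by (fastforce simp: eventually_sequentially g_def)
    then show ?thesis using True by (simp add: tendsto_eventually)
  next
    case False
    then have "g n x = 0" for n using f(2) x by (auto simp: g_def)
    then show ?thesis using False by simp
  qed
  show thesis
  proof (rule that)
    show "g n \<in> mspace (C_metric X)" for n
    proof -
      have "bounded (g n ` topspace X)"
        using g01 by (intro bounded_subset[OF bounded_closed_interval[of 0 1]]) auto
      then show ?thesis using cont by (auto simp: g_def)
    qed
    fix M assume M: "borel_measure_on X M" "finite_measure M"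
    interpret finite_measure M by fact
    have sp: "space M = topspace X" and U: "U \<in> sets M"
      using M(1) assms(2) by (auto simp: borel_measure_on_def)
    have "(\<lambda>n. integral\<^sup>L M (g n)) \<longlonglongrightarrow> integral\<^sup>L M (indicat_real U)"
      using U cont M(1) g01 g_lim sp
      by (intro integral_dominated_convergence[where w = "\<lambda>_. 1"])
        (auto intro: continuous_map_borel_measure_on)
    also have "integral\<^sup>L M (indicat_real U) = measure M U" using U sets.sets_into_space[OF U]
      by (simp add: Int_absorb2)
    finally show "(\<lambda>n. integral\<^sup>L M (g n)) \<longlonglongrightarrow> measure M U" .
  qed
qed

text \<open>Dynkin's pi-lambda argument: the relation passes from continuous functions to open sets
  by approximation, and from this intersection-stable generator to the whole sigma-algebra.\<close>

lemma combination_measures_eq_zero: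
  assumes "metrizable_space X"
    and I: "\<And>M. M \<in> I \<Longrightarrow> borel_measure_on X M \<and> prob_space M"
    and zero: "\<And>g. g \<in> mspace (C_metric X) \<Longrightarrow> (\<Sum>M\<in>I. c M * integral\<^sup>L M g) = 0"
    and A: "A \<in> sigma_sets (topspace X) {U. openin X U}"
  shows "(\<Sum>M\<in>I. c M * measure M A) = 0"
proof -
  have Int_st: "Int_stable {U. openin X U}" by (auto simp: Int_stable_def)
  have "{U. openin X U} \<subseteq> Pow (topspace X)" by (auto dest: openin_subset)
  from Int_st this A show ?thesis
  proof (induction rule: sigma_sets_induct_disjoint)
    case (basic U)
    then obtain g where g: "\<And>n::nat. g n \<in> mspace (C_metric X)"
      and lim: "\<And>M. borel_measure_on X M \<Longrightarrow> finite_measure M \<Longrightarrow>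
        (\<lambda>n. integral\<^sup>L M (g n)) \<longlonglongrightarrow> measure M U"
      using integral_open_set_tendsto[OF assms(1)] by blast
    have "(\<lambda>n. \<Sum>M\<in>I. c M * integral\<^sup>L M (g n)) \<longlonglongrightarrow> (\<Sum>M\<in>I. c M * measure M U)"
      using I lim by (intro tendsto_sum tendsto_mult tendsto_const) (auto simp: prob_space_def)
    then show ?case using zero[OF g] by (simp add: LIMSEQ_const_iff)
  next
    case empty
    show ?case by simp
  next
    case (compl A)
    \<comment> \<open>Complements require the combination of total masses to vanish. The whole
      carrier is open, so the approximation for open sets gives this.\<close>
    obtain g where g: "\<And>n::nat. g n \<in> mspace (C_metric X)"
      and lim: "\<And>M. borel_measure_on X M \<Longrightarrow> finite_measure M \<Longrightarrow>
        (\<lambda>n. integral\<^sup>L M (g n)) \<longlonglongrightarrow> measure M (topspace X)"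
      using integral_open_set_tendsto[OF assms(1) openin_topspace] by blast
    have "(\<lambda>n. \<Sum>M\<in>I. c M * integral\<^sup>L M (g n)) \<longlonglongrightarrow> (\<Sum>M\<in>I. c M * measure M (topspace X))"
      using I lim by (intro tendsto_sum tendsto_mult tendsto_const) (auto simp: prob_space_def)
    then have top: "(\<Sum>M\<in>I. c M * measure M (topspace X)) = 0"
      using zero[OF g] by (simp add: LIMSEQ_const_iff)
    have "measure M (topspace X - A) = measure M (topspace X) - measure M A" if "M \<in> I" for M
    proof -
      interpret prob_space M using I that by blast
      have "space M = topspace X" "A \<in> sets M"
        using I[OF that] compl by (auto simp: borel_measure_on_def)
      then show ?thesis using finite_measure_compl[of A] by simp
    qed
    then show ?case using top compl by (simp add: right_diff_distrib sum_subtractf)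
  next
    case (union A)
    have "(\<lambda>n. measure M (A n)) sums measure M (\<Union>n. A n)" if "M \<in> I" for M
    proof -
      interpret prob_space M using I that by blast
      show ?thesis using I[OF that] union
        by (intro finite_measure_UNION) (auto simp: borel_measure_on_def)
    qed
    then have "(\<lambda>n. \<Sum>M\<in>I. c M * measure M (A n)) sums (\<Sum>M\<in>I. c M * measure M (\<Union>n. A n))"
      by (intro sums_sum sums_mult)
    then show ?case using union by (simp add: sums_iff)
  qed
qed

section \<open>Integer iterates and the functional given by a combination of invariant
  measures\<close>

lemma continuous_map_int_iterate:
  assumes "homeomorphic_map X X T"
  shows "continuous_map X X (int_iterate X T n)"
proof -
  have pow: "continuous_map X X (f ^^ k)" if "continuous_map X X f" for f k
    using that by (induction k) (auto intro: continuous_map_compose simp: id_def[symmetric])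
  have "continuous_map X X T" using assms by (rule homeomorphic_imp_continuous_map)
  moreover have "continuous_map X X (inv_into (topspace X) T)"
  proof -
    obtain S where S: "homeomorphic_maps X X T S"
      using assms by (auto simp: homeomorphic_map_maps)
    \<comment> \<open>The continuous inverse \<open>S\<close> and \<open>inv_into\<close> need only
      agree on the carrier; that suffices to transfer continuity.\<close>
    have "S x = inv_into (topspace X) T x" if "x \<in> topspace X" for x
      using S homeomorphic_imp_injective_map[OF assms] that
      by (metis continuous_map_image_subset_topspace homeomorphic_maps_def image_subset_iff inv_into_f_eq)
    then show ?thesis using S by (auto simp: homeomorphic_maps_def intro: continuous_map_eq)
  qed
  ultimately show ?thesis by (simp add: int_iterate_def pow)
qed

lemma integral_int_iterate:
  assumes hom: "homeomorphic_map X X T" and M: "borel_measure_on X M" "invariant_measure T M"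
    and f: "continuous_map X euclideanreal f"
  shows "integral\<^sup>L M (f \<circ> int_iterate X T n) = integral\<^sup>L M f"
proof -
  have sp: "space M = topspace X" using M(1) by (simp add: borel_measure_on_def)
  have T: "T \<in> M \<rightarrow>\<^sub>M M" "distr M M T = M" using M(2) by (auto simp: invariant_measure_def)
  have step: "integral\<^sup>L M (g \<circ> T) = integral\<^sup>L M g" if "continuous_map X euclideanreal g" for g
    using integral_distr[OF T(1), of g] continuous_map_borel_measure_on[OF M(1) that] T(2)
    by (simp add: comp_def)
  have S: "continuous_map X X (inv_into (topspace X) T)"
    using continuous_map_int_iterate[OF hom, of "-1"] by (simp add: int_iterate_def)
  have step': "integral\<^sup>L M (g \<circ> inv_into (topspace X) T) = integral\<^sup>L M g"
    if g: "continuous_map X euclideanreal g" for g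
  proof -
    \<comment> \<open>Invariance under the inverse follows from the forward step applied to
      \<open>g\<close> composed with the inverse: the two maps then cancel on the carrier.\<close>
    have "integral\<^sup>L M (g \<circ> inv_into (topspace X) T) = integral\<^sup>L M (g \<circ> inv_into (topspace X) T \<circ> T)"
      using step[OF continuous_map_compose[OF S g]] by simp
    also have "\<dots> = integral\<^sup>L M g"
      using homeomorphic_imp_injective_map[OF hom] sp by (intro Bochner_Integration.integral_cong) auto
    finally show ?thesis .
  qed
  \<comment> \<open>Stated for a general map \<open>R\<close>, to serve both \<open>T\<close> and
    its inverse. The induction absorbs one factor \<open>R\<close> into \<open>g\<close>, hence
    \<open>g\<close> must vary.\<close>
  have pow: "integral\<^sup>L M (g \<circ> (R ^^ k)) = integral\<^sup>L M g"
    if R: "continuous_map X X R" and inv: "\<And>g. continuous_map X euclideanreal g \<Longrightarrow> integral\<^sup>L M (g \<circ> R) = integral\<^sup>L M g"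
      and g: "continuous_map X euclideanreal g" for g R k
    using g
  proof (induction k arbitrary: g)
    case (Suc k)
    have "integral\<^sup>L M (g \<circ> (R ^^ Suc k)) = integral\<^sup>L M ((g \<circ> R) \<circ> (R ^^ k))"
      by (simp add: comp_assoc)
    also have "\<dots> = integral\<^sup>L M (g \<circ> R)"
      by (rule Suc.IH[OF continuous_map_compose[OF R Suc.prems]])
    also have "\<dots> = integral\<^sup>L M g" by (rule inv[OF Suc.prems])
    finally show ?case .
  qed simp
  show ?thesis
    unfolding int_iterate_def
    using pow[OF homeomorphic_imp_continuous_map[OF hom] step f] pow[OF S step' f] by simp
qed

text \<open>The functional \<open>L\<close> vanishes on the translates by invariance, on their span
  by linearity, and on the closure because it is bounded in the supremum norm.\<close>

lemma combination_cyclic_family_eq_zero: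
  assumes comp: "compact_space X" and hom: "homeomorphic_map X X T"
    and I: "\<And>M. M \<in> I \<Longrightarrow> borel_measure_on X M \<and> prob_space M \<and> invariant_measure T M"
    and F: "cyclic_family X T F"
    and zero: "\<And>f. f \<in> F \<Longrightarrow> (\<Sum>M\<in>I. c M * integral\<^sup>L M f) = 0"
    and g: "g \<in> mspace (C_metric X)"
  shows "(\<Sum>M\<in>I. c M * integral\<^sup>L M g) = 0"
proof -
  define L where "L h = (\<Sum>M\<in>I. c M * integral\<^sup>L M h)" for h
  have FC: "F \<subseteq> mspace (C_metric X)" using F by (simp add: cyclic_family_def)
  have trans: "h \<in> mspace (C_metric X) \<and> L h = 0" if h: "h \<in> translates X T F" for h
  proof -
    obtain f n where f: "f \<in> F" and hf: "h = restrict (f \<circ> int_iterate X T n) (topspace X)"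
      using h by (auto simp: translates_def)
    have cf: "continuous_map X euclideanreal f" using f FC mspace_C_metric[OF comp] by auto
    then have "continuous_map X euclideanreal h"
      using continuous_map_compose[OF continuous_map_int_iterate[OF hom, of n] cf]
      by (auto simp: hf intro: continuous_map_eq)
    then have "h \<in> mspace (C_metric X)" by (simp add: mspace_C_metric[OF comp] hf del: mspace_cfunspace)
    moreover have "integral\<^sup>L M h = integral\<^sup>L M f" if "M \<in> I" for M
    proof -
      have "integral\<^sup>L M h = integral\<^sup>L M (f \<circ> int_iterate X T n)"
        using I[OF that] by (intro Bochner_Integration.integral_cong) (auto simp: hf borel_measure_on_def)
      also have "\<dots> = integral\<^sup>L M f" using I[OF that] cf hom by (intro integral_int_iterate) auto
      finally show ?thesis .
    qed
    then have "L h = 0" using zero[OF f] by (simp add: L_def)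
    ultimately show ?thesis by blast
  qed
  have span: "L h = 0" if h: "h \<in> linear_span_on X (translates X T F)" for h
  proof -
    obtain S b where S: "finite S" "S \<subseteq> translates X T F"
      and hS: "h = restrict (\<lambda>x. \<Sum>k\<in>S. b k * k x) (topspace X)"
      using h by (auto simp: linear_span_on_def)
    have "integral\<^sup>L M h = (\<Sum>k\<in>S. b k * integral\<^sup>L M k)" if "M \<in> I" for M
    proof -
      have int: "integrable M k" if "k \<in> S" for k
        using I[OF \<open>M \<in> I\<close>] trans S that by (intro integrable_C_metric) (auto simp: prob_space_def)
      have "integral\<^sup>L M h = integral\<^sup>L M (\<lambda>x. \<Sum>k\<in>S. b k * k x)"
        using I[OF that] by (intro Bochner_Integration.integral_cong) (auto simp: hS borel_measure_on_def)
      also have "\<dots> = (\<Sum>k\<in>S. b k * integral\<^sup>L M k)" using int by simp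
      finally show ?thesis .
    qed
    then have "L h = (\<Sum>M\<in>I. \<Sum>k\<in>S. b k * (c M * integral\<^sup>L M k))"
      by (simp add: L_def sum_distrib_left mult.left_commute)
    also have "\<dots> = (\<Sum>k\<in>S. b k * L k)"
      by (subst sum.swap) (simp add: L_def sum_distrib_left)
    also have "\<dots> = 0" using trans S by (intro sum.neutral) auto
    finally show ?thesis .
  qed
  \<comment> \<open>An element \<open>h\<close> of the span within distance \<open>r\<close> of
    \<open>g\<close> has \<open>L h = 0\<close>. Each measure has mass 1, so \<open>L\<close> has
    norm at most the sum of the \<open>\<bar>c M\<bar>\<close>.\<close>
  have bound: "\<bar>L g\<bar> \<le> (\<Sum>M\<in>I. \<bar>c M\<bar>) * r" if "r > 0" for r
  proof -
    have "g \<in> mtopology_of (C_metric X) closure_of (linear_span_on X (translates X T F))"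
      using F g by (simp add: cyclic_family_def)
    then obtain h where hs: "h \<in> linear_span_on X (translates X T F)"
      and h: "h \<in> mspace (C_metric X)" and gh: "mdist (C_metric X) g h < r"
      using \<open>r > 0\<close> unfolding mtopology_of_def Metric_space.metric_closure_of[OF Metric_space_mspace_mdist]
      by (auto simp: Metric_space.in_mball[OF Metric_space_mspace_mdist] simp del: mspace_cfunspace)
    have close: "\<bar>g x - h x\<bar> \<le> r" if "x \<in> topspace X" for x
      using mdist_cfunspace_imp_mdist_le[OF g h less_imp_le[OF gh] that] by (simp add: dist_real_def)
    have "\<bar>integral\<^sup>L M g - integral\<^sup>L M h\<bar> \<le> r" if "M \<in> I" for M
    proof -
      interpret prob_space M using I[OF that] by blast
      have sp: "space M = topspace X" using I[OF that] by (simp add: borel_measure_on_def)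
      have int: "integrable M g" "integrable M h"
        using I[OF that] g h finite_measure_axioms by (auto intro!: integrable_C_metric simp del: mspace_cfunspace)
      have "\<bar>integral\<^sup>L M g - integral\<^sup>L M h\<bar> = \<bar>integral\<^sup>L M (\<lambda>x. g x - h x)\<bar>" using int by simp
      also have "\<dots> \<le> integral\<^sup>L M (\<lambda>x. \<bar>g x - h x\<bar>)" by (rule integral_abs_bound)
      also have "\<dots> \<le> integral\<^sup>L M (\<lambda>x. r)" using int close sp by (intro integral_mono) auto
      also have "\<dots> = r" by (simp add: prob_space)
      finally show ?thesis .
    qed
    then have "\<bar>c M * integral\<^sup>L M g - c M * integral\<^sup>L M h\<bar> \<le> \<bar>c M\<bar> * r" if "M \<in> I" for M
      using that by (auto simp: right_diff_distrib[symmetric] abs_mult intro: mult_left_mono)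
    then have "\<bar>L g - L h\<bar> \<le> (\<Sum>M\<in>I. \<bar>c M\<bar> * r)"
      unfolding L_def sum_subtractf[symmetric]
      by (intro order_trans[OF sum_abs] sum_mono)
    then show ?thesis using span[OF hs] by (simp add: sum_distrib_right)
  qed
  \<comment> \<open>Letting \<open>r\<close> decrease to 0 in the bound gives
    \<open>L g = 0\<close>.\<close>
  have "((\<lambda>r. (\<Sum>M\<in>I. \<bar>c M\<bar>) * r) \<longlongrightarrow> (\<Sum>M\<in>I. \<bar>c M\<bar>) * 0) (at_right 0)"
    by (intro tendsto_intros)
  moreover have "\<forall>\<^sub>F r in at_right 0. \<bar>L g\<bar> \<le> (\<Sum>M\<in>I. \<bar>c M\<bar>) * r"
    using bound by (auto simp: eventually_at_right_less intro: eventually_at_rightI[of 0 1])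
  ultimately have "\<bar>L g\<bar> \<le> (\<Sum>M\<in>I. \<bar>c M\<bar>) * 0"
    by (intro tendsto_lowerbound) auto
  then show ?thesis by (simp add: L_def)
qed

section \<open>Counting ergodic measures against a cyclic family\<close>

theorem corollary2p8:
  fixes X :: "'a topology" and T :: "'a \<Rightarrow> 'a"
  assumes "compact_space X" and "metrizable_space X"
    and "homeomorphic_map X X T"
  shows "ecard (ergodic_measures X T) \<le> Mult X T"
  unfolding Mult_def
proof (rule INF_greatest)
  fix F assume "F \<in> {F. cyclic_family X T F}"
  then have F: "cyclic_family X T F" by simp
  show "ecard (ergodic_measures X T) \<le> ecard F"
  proof (rule ccontr)
    assume "\<not> ?thesis"
    \<comment> \<open>An infinite \<open>F\<close> has \<open>ecard F\<close> equal to infinity, so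
      a failing inequality forces \<open>F\<close> to be finite.\<close>
    then have fin: "finite F" and "\<not> (finite (ergodic_measures X T) \<and> card (ergodic_measures X T) \<le> card F)"
      by (auto simp: ecard_def split: if_splits)
    \<comment> \<open>One measure more than there are functions is enough, and such a finite subset
      exists whether the set of ergodic measures is finite or infinite.\<close>
    then obtain I where I: "I \<subseteq> ergodic_measures X T" "finite I" "card I = Suc (card F)"
      by (metis infinite_arbitrarily_large not_less_eq_eq obtain_subset_with_card_n)
    \<comment> \<open>The integrals of the functions in \<open>F\<close> form the coefficient
      matrix: one equation per function, one unknown per measure.\<close>
    obtain c where nz: "\<exists>M\<in>I. c M \<noteq> 0"
      and c: "\<And>f. f \<in> F \<Longrightarrow> (\<Sum>M\<in>I. c M * integral\<^sup>L M f) = 0"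
      using exists_nontrivial_relation[OF fin I(2), of "\<lambda>M. integral\<^sup>L M"] I(3) by auto
    have IM: "borel_measure_on X M" "prob_space M" "ergodic_measure T M" "invariant_measure T M"
      if "M \<in> I" for M
      using I(1) that by (auto simp: ergodic_measures_def ergodic_measure_def)
    have "(\<Sum>M\<in>I. c M * integral\<^sup>L M g) = 0" if "g \<in> mspace (C_metric X)" for g
      using combination_cyclic_family_eq_zero[OF assms(1,3) _ F c that] IM by blast
    then have "(\<Sum>M\<in>I. c M * measure M A) = 0"
      if "A \<in> sigma_sets (topspace X) {U. openin X U}" for A
      using combination_measures_eq_zero[OF assms(2), of I c] IM that by blast
    then have "c M = 0" if "M \<in> I" for M
      using ergodic_measures_linearly_independent[OF I(2) _ _ that, where T = T and c = c
          and \<Sigma> = "sigma_sets (topspace X) {U. openin X U}"] IM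
      by (simp add: borel_measure_on_def)
    with nz show False by blast
  qed
qed

end
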